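(* Let $T>0$, $a>0$, $\nu\ge 0$, let $\mu,\tilde\mu\ge 0$ be the nudging parameters, and let $K,M\in\mathbb{N}$ with $M\le K$. Let $u$ be the $2\pi$-periodic solution on $[0,T]$ of the linear transport equation $$u_t=\nu u_{xx}-a u_x,\qquad u(0)=u_0,$$ with initial data $u_0$ given by a trigonometric polynomial of degree $K$. Let $(v^n,\tilde v^n)_{n\ge1}$ be the back-and-forth nudging sequence defined on $[0,T]$ by $$v^n_t=\nu v^n_{xx}-a v^n_x+\mu P_M(u-v^n),\qquad v^n(0)=\tilde v^{n-1}(0),$$ $$\tilde v^n_t=\nu \tilde v^n_{xx}-a\tilde v^n_x-\tilde\mu P_M(u-\tilde v^n),\qquad \tilde v^n(T)=v^n(T),$$ for $n=1,2,\dots$, initialized with $v^1(0)=\tilde v^0(0)=v_0$, where $v_0$ is a trigonometric polynomial of degree $K$. Then $$\lim_{n\to\infty}\|v^n(0)-u_0\|_{L^2_{\mathrm{per}}}=\|Q_M(v_0-u_0)\|_{L^2_{\mathrm{per}}}.$$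
   Context: $L^2_{\mathrm{per}}$ is the space of $2\pi$-periodic functions on $\mathbb{R}$ that are square-integrable over a period, with norm $\|g\|_{L^2_{\mathrm{per}}}=\left(\int_0^{2\pi}|g|^2\,dx\right)^{1/2}$. A trigonometric polynomial of degree $K$ is a function $\sum_{|k|\le K}c_k e^{ikx}$ whose highest frequency is $K$. $P_M$ is the projection of $L^2_{\mathrm{per}}$ onto the Fourier modes $e^{ikx}$ with $|k|\le M$, and $Q_M=I-P_M$. All equations are posed with $2\pi$-periodic boundary conditions in $x$, and solutions of the transport equation take values in $L^2_{\mathrm{per}}$ for $t\in[0,T]$. The equation for $\tilde v^n$ is solved backward in time from the terminal condition at $t=T$. Standing assumption: existence and uniqueness of solutions to the forward ($v^n$) and backward ($\tilde v^n$) equations.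
   Formalization: The nudging parameters are assumed not both zero (μ>0 or μ̃>0): for μ=μ̃=0 one has v^n(0)=v_0 for all n, and the stated limit fails whenever P_M(v_0−u_0)≠0, e.g. K=M=0, u_0=1, v_0=2. *)

theory Defs
  imports "HOL-Analysis.Analysis"
begin

text \<open>
  Elements of \<open>L\<^sup>2\<close> are represented by functions; equality of elements is \<open>eq_L2per\<close>.
  Values are complex, which includes the real-valued case.
\<close>

definition L2per :: "(real \<Rightarrow> complex) set" where
  "L2per = {f. (\<forall>x. f (x + 2 * pi) = f x) \<and> f \<in> borel_measurable lebesgue \<and>
     integrable (lebesgue_on {0..2 * pi}) (\<lambda>x. (cmod (f x))\<^sup>2)}"

definition eq_L2per :: "(real \<Rightarrow> complex) \<Rightarrow> (real \<Rightarrow> complex) \<Rightarrow> bool" where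
  "eq_L2per f g \<longleftrightarrow> (AE x in lebesgue. f x = g x)"

definition L2per_norm :: "(real \<Rightarrow> complex) \<Rightarrow> real" where
  "L2per_norm f = sqrt (LINT x|lebesgue_on {0..2 * pi}. (cmod (f x))\<^sup>2)"

definition fourier_mode :: "int \<Rightarrow> real \<Rightarrow> complex" where
  "fourier_mode k x = exp (\<i> * of_int k * of_real x)"

definition fourier_coeff :: "(real \<Rightarrow> complex) \<Rightarrow> int \<Rightarrow> complex" where
  "fourier_coeff f k =
     (LINT x|lebesgue_on {0..2 * pi}. f x * fourier_mode (- k) x) / of_real (2 * pi)"

definition trig_poly :: "nat \<Rightarrow> (real \<Rightarrow> complex) \<Rightarrow> bool" where
  "trig_poly K f \<longleftrightarrow> (\<exists>c :: int \<Rightarrow> complex.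
     f = (\<lambda>x. \<Sum>k = - int K..int K. c k * fourier_mode k x) \<and>
     (c (int K) \<noteq> 0 \<or> c (- int K) \<noteq> 0))"

definition proj_P :: "nat \<Rightarrow> (real \<Rightarrow> complex) \<Rightarrow> real \<Rightarrow> complex" where
  "proj_P M f x = (\<Sum>k = - int M..int M. fourier_coeff f k * fourier_mode k x)"

definition proj_Q :: "nat \<Rightarrow> (real \<Rightarrow> complex) \<Rightarrow> real \<Rightarrow> complex" where
  "proj_Q M f x = f x - proj_P M f x"

definition dx :: "(real \<Rightarrow> complex) \<Rightarrow> real \<Rightarrow> complex" where
  "dx f x = vector_derivative f (at x)"

definition smooth_periodic :: "(real \<Rightarrow> complex) \<Rightarrow> bool" where
  "smooth_periodic \<phi> \<longleftrightarrow> (\<forall>x. \<phi> (x + 2 * pi) = \<phi> x) \<and>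
     (\<forall>n x. (dx ^^ n) \<phi> differentiable (at x))"

text \<open>
  \<open>transport_solution \<nu> a T F w\<close>: on \<open>[0,T]\<close>, \<open>w\<close> is an \<open>L\<^sup>2\<close>-valued \<open>2\<pi>\<close>-periodic solution of
  \<open>w\<^sub>t = \<nu> w\<^sub>x\<^sub>x - a w\<^sub>x + F\<close> in the weak sense: the equation is multiplied by a smooth periodic
  test function, integrated over a period, and the \<open>x\<close>-derivatives are moved onto the test
  function by parts (whence the sign of \<open>a\<close>). The time derivative is one-sided at \<open>0\<close> and \<open>T\<close>,
  and no initial or terminal condition is built in, so the same notion serves for problems
  solved forward and backward in time.
\<close>

definition transport_solution ::
  "real \<Rightarrow> real \<Rightarrow> real \<Rightarrow> (real \<Rightarrow> real \<Rightarrow> complex) \<Rightarrow> (real \<Rightarrow> real \<Rightarrow> complex) \<Rightarrow> bool" where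
  "transport_solution \<nu> a T F w \<longleftrightarrow>
     (\<forall>t\<in>{0..T}. w t \<in> L2per) \<and>
     (\<forall>\<phi>. smooth_periodic \<phi> \<longrightarrow> (\<forall>t\<in>{0..T}.
        ((\<lambda>s. LINT x|lebesgue_on {0..2 * pi}. w s x * \<phi> x) has_vector_derivative
           (LINT x|lebesgue_on {0..2 * pi}.
              w t x * (of_real \<nu> * dx (dx \<phi>) x + of_real a * dx \<phi> x) + F t x * \<phi> x))
        (at t within {0..T})))"

end

theory Submission
  imports Defs
begin

text \<open>
  The problem is diagonal in the Fourier basis. Testing the weak equations with \<open>e\<^sup>-\<^sup>i\<^sup>k\<^sup>x\<close>
  shows that the \<open>k\<close>-th coefficient of the error \<open>u - v\<^sub>n\<close> solves a scalar linear equation with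
  exponent \<open>r\<^sub>k - \<mu>\<close> if \<open>\<bar>k\<bar> \<le> M\<close> and \<open>r\<^sub>k\<close> otherwise, where \<open>r\<^sub>k = - \<nu> k\<^sup>2 - i a k\<close>. For the
  backward problem, \<open>- \<mu>\<close> is replaced by \<open>+ \<mu>'\<close>, but the equation is run from \<open>T\<close> down to \<open>0\<close>.
  Hence over one cycle the factors \<open>exp (r\<^sub>k T)\<close> cancel, and the error at time \<open>0\<close> is multiplied by
  \<open>exp (- (\<mu> + \<mu>') T) < 1\<close> on the observed modes and by \<open>1\<close> on the others
  (\<open>nudging_cycle_coeff\<close>).

  The coefficients of the initial error vanish for \<open>\<bar>k\<bar> > K\<close>, so those of every later error do,
  too. To pass from coefficients to the norm of an error that is known only as an element of
  \<open>L\<^sup>2\<close>, the completeness of the Fourier modes is needed: an integrable function whose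
  coefficients all vanish is zero almost everywhere (\<open>vanishing_coeffs_imp_AE_zero\<close>). Such a
  function is orthogonal to all polynomials on the unit circle, hence by Stone--Weierstrass to all
  continuous functions, hence by dominated convergence to the indicators of closed sets; inner
  regularity of Lebesgue measure then leaves no room for a set where it is nonzero.

  The errors are thus sums over \<open>\<bar>k\<bar> \<le> K\<close>, their norms are finite sums of squares
  (\<open>L2per_norm_finite_spectrum\<close>), and the limit can be taken term by term: the observed modes
  disappear, and what remains is the norm of the unobserved part of the initial error.
\<close>

section \<open>Integration over one period\<close>

abbreviation one_period :: "real measure" where
  "one_period \<equiv> lebesgue_on {0..2 * pi}"

lemma integrable_mult_continuous:
  fixes f g :: "real \<Rightarrow> complex"
  assumes f: "integrable one_period f" and g: "continuous_on {0..2 * pi} g"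
  shows "integrable one_period (\<lambda>x. f x * g x)"
proof -
  obtain B where B: "\<And>x. x \<in> {0..2 * pi} \<Longrightarrow> norm (g x) \<le> B"
    using compact_imp_bounded[OF compact_continuous_image[OF g compact_Icc]]
    unfolding bounded_iff by (metis imageI)
  have gm: "g \<in> borel_measurable one_period"
    using g by (intro continuous_imp_measurable_on_sets_lebesgue) auto
  show ?thesis
  proof (rule Bochner_Integration.integrable_bound)
    show "integrable one_period (\<lambda>x. B * norm (f x))"
      using f by simp
    show "(\<lambda>x. f x * g x) \<in> borel_measurable one_period"
      using borel_measurable_integrable[OF f] gm by measurable
    show "AE x in one_period. norm (f x * g x) \<le> norm (B * norm (f x))"
    proof (rule AE_I2)
      fix x assume "x \<in> space one_period"
      then have "norm (g x) \<le> B" using B by simp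
      then have "norm (f x) * norm (g x) \<le> norm (f x) * \<bar>B\<bar>"
        by (intro mult_left_mono) auto
      then show "norm (f x * g x) \<le> norm (B * norm (f x))"
        by (simp add: norm_mult abs_mult mult.commute)
    qed
  qed
qed

lemma integrable_one_period_continuous:
  fixes g :: "real \<Rightarrow> complex"
  assumes "continuous_on {0..2 * pi} g"
  shows "integrable one_period g"
  using integrable_mult_continuous[OF Lebesgue_Measure.integrable_const_ivl assms, of 1] by simp

lemma L2per_integrable:
  assumes "f \<in> L2per"
  shows "integrable one_period f"
proof (rule Bochner_Integration.integrable_bound)
  show "integrable one_period (\<lambda>x. 1 + (cmod (f x))\<^sup>2)"
    using assms by (auto simp: L2per_def)
  show "f \<in> borel_measurable one_period"
    using assms by (auto simp: L2per_def intro: measurable_restrict_space1)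
  show "AE x in one_period. norm (f x) \<le> norm (1 + (cmod (f x))\<^sup>2)"
  proof (rule AE_I2)
    fix x
    have "0 \<le> (cmod (f x) - 1)\<^sup>2 + (cmod (f x))\<^sup>2 + 1" by simp
    then have "2 * cmod (f x) \<le> 2 * (1 + (cmod (f x))\<^sup>2)"
      by (simp add: power2_eq_square algebra_simps)
    then show "norm (f x) \<le> norm (1 + (cmod (f x))\<^sup>2)" by simp
  qed
qed

lemma eq_L2per_AE_one_period:
  "eq_L2per f g \<Longrightarrow> AE x in one_period. f x = g x"
  by (auto simp: eq_L2per_def AE_restrict_space_iff elim: eventually_mono)

section \<open>Fourier modes and Fourier coefficients\<close>

lemma fourier_mode_eq_cis: "fourier_mode k x = cis (of_int k * x)"
  by (simp add: fourier_mode_def cis_conv_exp mult.assoc)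

lemma fourier_mode_0 [simp]: "fourier_mode 0 x = 1"
  by (simp add: fourier_mode_def)

lemma fourier_mode_mult: "fourier_mode j x * fourier_mode k x = fourier_mode (j + k) x"
  by (simp add: fourier_mode_eq_cis cis_mult algebra_simps)

lemma cnj_fourier_mode: "cnj (fourier_mode k x) = fourier_mode (- k) x"
  by (simp add: fourier_mode_eq_cis cis_cnj)

lemma continuous_on_fourier_mode [continuous_intros]: "continuous_on S (fourier_mode k)"
  unfolding fourier_mode_def by (intro continuous_intros)

lemma fourier_mode_periodic: "fourier_mode k (x + 2 * pi) = fourier_mode k x"
proof -
  have "fourier_mode k (x + 2 * pi) = cis (of_int k * x) * cis (2 * pi * of_int k)"
    by (simp add: fourier_mode_eq_cis cis_mult algebra_simps)
  then show ?thesis by (simp add: fourier_mode_eq_cis cis_multiple_2pi)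
qed

lemma fourier_mode_has_vector_derivative:
  "(fourier_mode k has_vector_derivative \<i> * of_int k * fourier_mode k x) (at x within S)"
proof -
  have "((\<lambda>z. exp (\<i> * of_int k * z)) has_field_derivative
          \<i> * of_int k * exp (\<i> * of_int k * of_real x)) (at (of_real x))"
    by (auto intro!: derivative_eq_intros)
  from has_vector_derivative_real_field[OF this, of S] show ?thesis
    by (simp add: fourier_mode_def[abs_def])
qed

lemma integrable_mult_fourier_mode:
  "integrable one_period f \<Longrightarrow> integrable one_period (\<lambda>x. f x * fourier_mode k x)"
  by (intro integrable_mult_continuous continuous_intros)

lemma fourier_coeff_add:
  assumes "integrable one_period f" "integrable one_period g"
  shows "fourier_coeff (\<lambda>x. f x + g x) k = fourier_coeff f k + fourier_coeff g k"
  using assms[THEN integrable_mult_fourier_mode[where k = "- k"]]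
  by (simp add: fourier_coeff_def distrib_right add_divide_distrib)

lemma fourier_coeff_cmult: "fourier_coeff (\<lambda>x. c * f x) k = c * fourier_coeff f k"
  by (simp add: fourier_coeff_def mult.assoc)

lemma fourier_coeff_diff:
  assumes "integrable one_period f" "integrable one_period g"
  shows "fourier_coeff (\<lambda>x. f x - g x) k = fourier_coeff f k - fourier_coeff g k"
  using assms[THEN integrable_mult_fourier_mode[where k = "- k"]]
  by (simp add: fourier_coeff_def left_diff_distrib diff_divide_distrib)

lemma fourier_coeff_cong_AE:
  assumes "integrable one_period f" "integrable one_period g"
    and "AE x in one_period. f x = g x"
  shows "fourier_coeff f k = fourier_coeff g k"
proof -
  have "(LINT x|one_period. f x * fourier_mode (- k) x)
      = (LINT x|one_period. g x * fourier_mode (- k) x)"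
    using assms by (intro integral_cong_AE borel_measurable_integrable
        integrable_mult_fourier_mode) auto
  then show ?thesis by (simp add: fourier_coeff_def)
qed

lemma integral_fourier_mode:
  "(LINT x|one_period. fourier_mode k x) = (if k = 0 then of_real (2 * pi) else 0)"
proof (cases "k = 0")
  case True
  then show ?thesis by (simp add: measure_restrict_space scaleR_conv_of_real)
next
  case False
  define F where "F x = fourier_mode k x / (\<i> * of_int k)" for x
  have "(F has_vector_derivative fourier_mode k x) (at x within {0..2 * pi})" for x
    using has_vector_derivative_divide[OF fourier_mode_has_vector_derivative, of k "\<i> * of_int k" x] False
    by (simp add: F_def[abs_def])
  then have "(fourier_mode k has_integral F (2 * pi) - F 0) {0..2 * pi}"
    by (intro fundamental_theorem_of_calculus) auto
  moreover have "F (2 * pi) = F 0"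
    using fourier_mode_periodic[of k 0] by (simp add: F_def)
  ultimately have "integral {0..2 * pi} (fourier_mode k) = 0"
    by (simp add: integral_unique)
  moreover have "(LINT x|one_period. fourier_mode k x) = integral {0..2 * pi} (fourier_mode k)"
    by (intro lebesgue_integral_eq_integral integrable_one_period_continuous continuous_intros) auto
  ultimately show ?thesis using False by simp
qed

lemma fourier_coeff_fourier_mode:
  "fourier_coeff (fourier_mode j) k = (if j = k then 1 else 0)"
  by (simp add: fourier_coeff_def fourier_mode_mult integral_fourier_mode)

lemma integrable_mode_sum: "integrable one_period (\<lambda>x. \<Sum>k\<in>A. c k * fourier_mode k x)"
  by (intro integrable_one_period_continuous continuous_intros)

lemma fourier_coeff_mode_sum:
  assumes "finite A"
  shows "fourier_coeff (\<lambda>x. \<Sum>j\<in>A. c j * fourier_mode j x) k = (if k \<in> A then c k else 0)"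
  using assms
proof (induction A rule: finite_induct)
  case empty
  show ?case by (simp add: fourier_coeff_def)
next
  case (insert i A)
  then have "fourier_coeff (\<lambda>x. \<Sum>j\<in>insert i A. c j * fourier_mode j x) k
      = fourier_coeff (\<lambda>x. c i * fourier_mode i x + (\<Sum>j\<in>A. c j * fourier_mode j x)) k"
    by simp
  also have "\<dots> = c i * fourier_coeff (fourier_mode i) k
      + fourier_coeff (\<lambda>x. \<Sum>j\<in>A. c j * fourier_mode j x) k"
    by (subst fourier_coeff_add)
      (auto intro!: integrable_mode_sum integrable_one_period_continuous continuous_intros
        simp: fourier_coeff_cmult)
  finally show ?case using insert by (auto simp: fourier_coeff_fourier_mode)
qed

lemma fourier_coeff_proj_P:
  "fourier_coeff (proj_P M f) k = (if \<bar>k\<bar> \<le> int M then fourier_coeff f k else 0)"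
proof -
  have "proj_P M f = (\<lambda>x. \<Sum>k = - int M..int M. fourier_coeff f k * fourier_mode k x)"
    by (simp add: fun_eq_iff proj_P_def)
  then show ?thesis by (auto simp: fourier_coeff_mode_sum)
qed

lemma L2per_norm_mode_sum:
  assumes "finite A"
  shows "L2per_norm (\<lambda>x. \<Sum>k\<in>A. c k * fourier_mode k x)
       = sqrt (2 * pi * (\<Sum>k\<in>A. (cmod (c k))\<^sup>2))"
proof -
  let ?f = "\<lambda>x. \<Sum>k\<in>A. c k * fourier_mode k x"
  have int: "integrable one_period (\<lambda>x. ?f x * fourier_mode k x)" for k
    by (intro integrable_one_period_continuous continuous_intros)
  have "of_real (LINT x|one_period. (cmod (?f x))\<^sup>2) = (LINT x|one_period. ?f x * cnj (?f x))"
    by (simp only: complex_norm_square[symmetric] integral_complex_of_real[symmetric])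
  also have "\<dots> = (LINT x|one_period. (\<Sum>k\<in>A. cnj (c k) * (?f x * fourier_mode (- k) x)))"
    by (simp add: cnj_fourier_mode sum_distrib_left mult_ac)
  also have "\<dots> = (\<Sum>k\<in>A. cnj (c k) * (LINT x|one_period. ?f x * fourier_mode (- k) x))"
    using int by (subst Bochner_Integration.integral_sum) auto
  also have "\<dots> = (\<Sum>k\<in>A. cnj (c k) * (of_real (2 * pi) * fourier_coeff ?f k))"
    by (simp add: fourier_coeff_def)
  also have "\<dots> = (\<Sum>k\<in>A. of_real (2 * pi * (cmod (c k))\<^sup>2))"
    using assms by (intro sum.cong) (auto simp: fourier_coeff_mode_sum complex_norm_square[symmetric] mult_ac)
  also have "\<dots> = of_real (2 * pi * (\<Sum>k\<in>A. (cmod (c k))\<^sup>2))"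
    by (simp add: sum_distrib_left)
  finally show ?thesis
    unfolding L2per_norm_def by (simp only: of_real_eq_iff)
qed

section \<open>Completeness of the Fourier modes\<close>

lemma fourier_coeff_mult_fourier_mode:
  "fourier_coeff (\<lambda>x. f x * fourier_mode j x) k = fourier_coeff f (k - j)"
  by (simp add: fourier_coeff_def fourier_mode_mult mult.assoc)

text \<open>
  Functions with vanishing Fourier coefficients form a module over the trigonometric
  polynomials. This makes the induction over polynomials on the unit circle go through without
  ever writing such a polynomial as a sum of modes.
\<close>

lemma vanishing_coeffs_mult_polynomial:
  assumes "real_polynomial_function g"
    and "integrable one_period f" and "\<And>k. fourier_coeff f k = 0"
  shows "integrable one_period (\<lambda>x. f x * of_real (g (cis x))) \<and>
         (\<forall>k. fourier_coeff (\<lambda>x. f x * of_real (g (cis x))) k = 0)"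
  using assms
proof (induction g arbitrary: f rule: real_polynomial_function.induct)
  case (linear g)
  interpret bounded_linear g by fact
  (* Euler's formulas turn a linear form in (cos x, sin x) into one in the modes 1 and -1. *)
  define p q where "p = (of_real (g 1) - \<i> * of_real (g \<i>)) / 2"
    and "q = (of_real (g 1) + \<i> * of_real (g \<i>)) / 2"
  have "complex_of_real (g (cis x)) = p * fourier_mode 1 x + q * fourier_mode (- 1) x" for x
  proof -
    have "cis x = cos x *\<^sub>R 1 + sin x *\<^sub>R \<i>"
      by (simp add: complex_eq_iff)
    then have "g (cis x) = cos x * g 1 + sin x * g \<i>"
      by (simp add: add scaleR)
    then show ?thesis
      by (simp add: p_def q_def fourier_mode_eq_cis complex_eq_iff field_simps)
  qed
  then have eq: "(\<lambda>x. f x * of_real (g (cis x)))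
      = (\<lambda>x. p * (f x * fourier_mode 1 x) + q * (f x * fourier_mode (- 1) x))"
    by (simp add: algebra_simps)
  show ?case
    unfolding eq using linear.prems
    by (simp add: fourier_coeff_add fourier_coeff_cmult fourier_coeff_mult_fourier_mode
        integrable_mult_fourier_mode)
next
  case (const c)
  then show ?case
    by (simp add: mult.commute[of _ "of_real c"] fourier_coeff_cmult)
next
  case (add g h)
  then show ?case
    by (simp add: distrib_left fourier_coeff_add)
next
  case (mult g h)
  then show ?case
    by (simp add: mult.assoc[symmetric])
qed

text \<open>
  A continuous function of \<open>e\<^sup>i\<^sup>x\<close> is a uniform limit of polynomials on the unit circle
  (Stone--Weierstrass), and \<open>f\<close> is orthogonal to each of them. Working on the circle avoids
  periodicity conditions on the approximants.
\<close>

lemma integral_mult_continuous_on_circle_eq_0: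
  fixes G :: "complex \<Rightarrow> real"
  assumes f: "integrable one_period f" and 0: "\<And>k. fourier_coeff f k = 0"
    and G: "continuous_on (sphere 0 1) G"
  shows "(LINT x|one_period. f x * of_real (G (cis x))) = 0"
proof -
  have contG: "continuous_on {0..2 * pi} (\<lambda>x. complex_of_real (G (cis x)))"
    by (intro continuous_on_of_real continuous_on_compose2[OF G] continuous_intros) auto
  have "cmod (LINT x|one_period. f x * of_real (G (cis x)))
      \<le> (LINT x|one_period. cmod (f x)) * e" if "e > 0" for e
  proof -
    obtain g where g: "real_polynomial_function g"
      and close: "\<And>z. z \<in> sphere 0 1 \<Longrightarrow> \<bar>G z - g z\<bar> < e"
      using Stone_Weierstrass_real_polynomial_function[OF compact_sphere G \<open>e > 0\<close>] by metis
    note van = vanishing_coeffs_mult_polynomial[OF g f 0]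
    have "(LINT x|one_period. f x * of_real (g (cis x)))
        = of_real (2 * pi) * fourier_coeff (\<lambda>x. f x * of_real (g (cis x))) 0"
      by (simp add: fourier_coeff_def)
    then have "(LINT x|one_period. f x * of_real (g (cis x))) = 0"
      using van by simp
    then have "(LINT x|one_period. f x * of_real (G (cis x)))
        = (LINT x|one_period. f x * of_real (G (cis x)) - f x * of_real (g (cis x)))"
      using van integrable_mult_continuous[OF f contG]
      by (subst Bochner_Integration.integral_diff) auto
    also have "cmod \<dots> \<le> (LINT x|one_period. cmod (f x) * e)"
    proof (rule Bochner_Integration.integral_norm_bound_integral)
      show "integrable one_period (\<lambda>x. f x * of_real (G (cis x)) - f x * of_real (g (cis x)))"
        using van integrable_mult_continuous[OF f contG] by auto
      show "integrable one_period (\<lambda>x. cmod (f x) * e)"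
        using f by simp
      fix x
      have "cmod (f x * of_real (G (cis x)) - f x * of_real (g (cis x)))
          = cmod (f x) * \<bar>G (cis x) - g (cis x)\<bar>"
        by (simp flip: right_diff_distrib of_real_diff add: norm_mult)
      also have "\<dots> \<le> cmod (f x) * e"
        using close[of "cis x"] by (intro mult_left_mono) auto
      finally show "cmod (f x * of_real (G (cis x)) - f x * of_real (g (cis x)))
          \<le> cmod (f x) * e" .
    qed
    finally show ?thesis by simp
  qed
  note bound = this
  define I where "I = (LINT x|one_period. cmod (f x))"
  have "I \<ge> 0" unfolding I_def by (intro Bochner_Integration.integral_nonneg) auto
  have "cmod (LINT x|one_period. f x * of_real (G (cis x))) \<le> 0"
  proof (rule field_le_epsilon)
    fix e :: real assume "e > 0"
    then have "e / (I + 1) > 0" using \<open>I \<ge> 0\<close> by simp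
    moreover have "I * (e / (I + 1)) \<le> e"
      using \<open>I \<ge> 0\<close> \<open>e > 0\<close> by (simp add: field_simps)
    ultimately show "cmod (LINT x|one_period. f x * of_real (G (cis x))) \<le> 0 + e"
      using bound[of "e / (I + 1)"] by (simp add: I_def)
  qed
  then show ?thesis by simp
qed

lemma tendsto_indicator_closed:
  fixes z :: "'a :: metric_space"
  assumes "closed C" "C \<noteq> {}"
  shows "(\<lambda>n. max 0 (1 - real n * infdist z C)) \<longlonglongrightarrow> indicator C z"
proof (cases "z \<in> C")
  case True
  then show ?thesis by simp
next
  case False
  then have pos: "infdist z C > 0"
    using assms in_closed_iff_infdist_zero[of C z] infdist_nonneg[of z C] by linarith
  then obtain N where N: "1 \<le> real N * infdist z C"
    using reals_Archimedean3[OF pos] less_imp_le by metis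
  have "\<forall>\<^sub>F n in sequentially. max 0 (1 - real n * infdist z C) = indicator C z"
    using eventually_ge_at_top[of N]
  proof eventually_elim
    case (elim n)
    then have "real N * infdist z C \<le> real n * infdist z C"
      using pos by (intro mult_right_mono) auto
    then show ?case using N False by simp
  qed
  then show ?thesis by (rule tendsto_eventually)
qed

text \<open>
  The functions \<open>max 0 (1 - n * infdist z C)\<close> are continuous, bounded by 1 and decrease to the
  indicator of \<open>C\<close>, so dominated convergence carries orthogonality over to closed sets.
\<close>

lemma integral_mult_indicator_circle_eq_0:
  assumes f: "integrable one_period f" and 0: "\<And>k. fourier_coeff f k = 0"
    and C: "closed C" "C \<noteq> {}"
  shows "(LINT x|one_period. f x * indicator C (cis x)) = 0"
proof -
  define h :: "nat \<Rightarrow> complex \<Rightarrow> real" where "h n z = max 0 (1 - real n * infdist z C)" for n z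
  have h01: "\<bar>h n z\<bar> \<le> 1" for n z
    using infdist_nonneg[of z C] by (auto simp: h_def)
  have cont: "continuous_on S (h n)" for n S
    unfolding h_def[abs_def] by (intro continuous_intros)
  have lim: "(\<lambda>n. f x * of_real (h n (cis x))) \<longlonglongrightarrow> f x * indicator C (cis x)" for x
  proof -
    have "(\<lambda>n. complex_of_real (h n (cis x))) \<longlonglongrightarrow> of_real (indicator C (cis x))"
      unfolding h_def by (intro tendsto_of_real tendsto_indicator_closed C)
    moreover have "complex_of_real (indicator C (cis x)) = indicator C (cis x)"
      by (simp add: indicator_def)
    ultimately show ?thesis
      by (auto intro: tendsto_mult)
  qed
  have meas: "(\<lambda>x. f x * of_real (h n (cis x))) \<in> borel_measurable one_period" for n
    by (intro borel_measurable_integrable integrable_mult_continuous f continuous_on_of_real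
        continuous_on_compose2[OF cont[of UNIV]] continuous_intros) auto
  have "(\<lambda>n. LINT x|one_period. f x * of_real (h n (cis x)))
      \<longlonglongrightarrow> (LINT x|one_period. f x * indicator C (cis x))"
  proof (rule integral_dominated_convergence[where w = "\<lambda>x. cmod (f x)"])
    show "(\<lambda>x. f x * indicator C (cis x)) \<in> borel_measurable one_period"
      using lim meas by (rule borel_measurable_LIMSEQ_metric[rotated])
    show "AE x in one_period. norm (f x * of_real (h n (cis x))) \<le> cmod (f x)" for n
      using mult_left_mono[OF h01, of "cmod (f _)"] by (auto simp: norm_mult)
  qed (use f lim meas in auto)
  moreover have "(LINT x|one_period. f x * of_real (h n (cis x))) = 0" for n
    by (rule integral_mult_continuous_on_circle_eq_0[OF f 0 cont])
  ultimately show ?thesis by (simp add: LIMSEQ_const_iff)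
qed

text \<open>
  If \<open>Re f\<close> were positive on a set of positive measure, then by inner regularity it would be so on
  a closed set of positive measure, where its integral would be positive; but that integral
  vanishes.
\<close>

lemma vanishing_coeffs_Re_nonpos:
  assumes f: "integrable one_period f" and 0: "\<And>k. fourier_coeff f k = 0"
  shows "AE x in one_period. Re (f x) \<le> 0"
proof -
  (* The end points are left out because cis identifies them: on the open period, membership
     in a set can be read off from the image of the set on the circle. *)
  define A where "A = {x \<in> {0<..<2 * pi}. 0 < Re (f x)}"
  have "{x \<in> space one_period. 0 < Re (f x)} \<in> sets one_period"
    using borel_measurable_integrable[OF f] by measurable
  then have "{x \<in> space one_period. 0 < Re (f x)} \<in> sets lebesgue"
    by (auto simp: sets_restrict_space intro!: sets.Int)
  then have "{x \<in> space one_period. 0 < Re (f x)} \<inter> {0<..<2 * pi} \<in> sets lebesgue"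
    by (intro sets.Int) auto
  also have "{x \<in> space one_period. 0 < Re (f x)} \<inter> {0<..<2 * pi} = A"
    by (auto simp: A_def)
  finally have A: "A \<in> sets lebesgue" .
  have null: "emeasure lebesgue C = 0" if C: "closed C" "C \<subseteq> A" for C
  proof (cases "C = {}")
    case False
    have Csets: "C \<in> sets one_period"
      using C by (auto simp: sets_restrict_space A_def intro!: image_eqI[of _ _ C] borel_closed)
    have "C \<subseteq> {0..2 * pi}"
      using C by (auto simp: A_def)
    then have "compact C"
      using C bounded_subset[OF bounded_closed_interval] by (simp add: compact_eq_bounded_closed)
    then have "closed (cis ` C)"
      by (intro compact_imp_closed compact_continuous_image continuous_intros)
    then have z: "(LINT x|one_period. f x * indicator (cis ` C) (cis x)) = 0"
      using False by (intro integral_mult_indicator_circle_eq_0 f 0) auto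
    have in_iff: "cis x \<in> cis ` C \<longleftrightarrow> x \<in> C" if x: "x \<in> {0..2 * pi}" for x
    proof
      assume "cis x \<in> cis ` C"
      then obtain y where y: "y \<in> C" "cis x = cis y" by auto
      then have "0 < y" "y < 2 * pi" using C by (auto simp: A_def)
      obtain n :: int where n: "x = y + 2 * pi * of_int n"
        using y(2) sin_cos_eq_iff[of x y] by (auto simp: complex_eq_iff)
      then have "2 * pi * of_int n < 2 * pi * 1" "2 * pi * (- 1) < 2 * pi * of_int n"
        using x[unfolded atLeastAtMost_iff] \<open>0 < y\<close> \<open>y < 2 * pi\<close> by linarith+
      moreover have "0 < 2 * pi" by simp
      ultimately have "real_of_int n < 1" "- 1 < real_of_int n"
        by (simp_all only: mult_less_cancel_left_pos)
      then have "n = 0" by linarith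
      then show "x \<in> C" using n y by simp
    qed auto
    have "(LINT x|one_period. f x * indicator (cis ` C) (cis x))
        = (LINT x|one_period. indicator C x *\<^sub>R f x)"
      by (intro Bochner_Integration.integral_cong) (auto simp: in_iff indicator_def)
    moreover have int: "integrable one_period (\<lambda>x. indicator C x *\<^sub>R f x)"
      using integrable_mult_indicator[OF Csets f] .
    moreover have "(LINT x|one_period. Re (indicator C x *\<^sub>R f x))
        = Re (LINT x|one_period. indicator C x *\<^sub>R f x)"
      using int by (rule integral_Re)
    ultimately have "(LINT x|one_period. Re (indicator C x *\<^sub>R f x)) = 0"
      using z by (simp only: zero_complex.sel)
    then have "AE x in one_period. Re (indicator C x *\<^sub>R f x) = 0"
    proof (subst (asm) integral_nonneg_eq_0_iff_AE)
      show "integrable one_period (\<lambda>x. Re (indicator C x *\<^sub>R f x))"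
        using int by (rule integrable_Re)
      show "AE x in one_period. 0 \<le> Re (indicator C x *\<^sub>R f x)"
        using C by (intro AE_I2) (auto simp: A_def indicator_def)
    qed
    then have "AE x in one_period. x \<notin> C"
      using C by (auto simp: A_def indicator_def elim!: eventually_mono)
    then have "AE x in lebesgue. x \<notin> C"
      using C by (auto simp: A_def AE_restrict_space_iff elim!: eventually_mono)
    then show ?thesis
      using C by (subst (asm) AE_iff_measurable[of C]) (auto intro: borel_closed)
  qed simp
  have "emeasure lebesgue A \<le> ennreal e" if e: "e > 0" for e
  proof -
    obtain C where C: "closed C" "C \<subseteq> A" "emeasure lebesgue (A - C) < ennreal e"
      using sets_lebesgue_inner_closed[OF A e] by metis
    have "emeasure lebesgue A = emeasure lebesgue C + emeasure lebesgue (A - C)"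
      using C A by (subst plus_emeasure) (auto simp: Un_absorb1 borel_closed)
    then show ?thesis using C null[of C] by simp
  qed
  then have "emeasure lebesgue A = 0"
    by (metis ennreal_le_epsilon add_0 le_zero_eq)
  then have "AE x in lebesgue. x \<notin> A"
    using A by (intro AE_not_in) (auto simp: null_sets_def)
  moreover have "AE x in lebesgue. x \<noteq> 0 \<and> x \<noteq> 2 * pi"
    by (auto intro!: AE_lborel_singleton AE_completion)
  ultimately have "AE x in lebesgue. x \<in> {0..2 * pi} \<longrightarrow> Re (f x) \<le> 0"
    by eventually_elim (auto simp: A_def)
  then show ?thesis by (simp add: AE_restrict_space_iff)
qed

text \<open>
  The one-sided bound applies to every multiple of \<open>f\<close>; the multiples by \<open>\<plusminus>1\<close> and \<open>\<plusminus>\<i>\<close>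
  pin down both the real and the imaginary part.
\<close>

lemma vanishing_coeffs_imp_AE_zero:
  assumes f: "integrable one_period f" and 0: "\<And>k. fourier_coeff f k = 0"
  shows "AE x in one_period. f x = 0"
proof -
  have "AE x in one_period. Re (c * f x) \<le> 0" for c
    using f 0 by (intro vanishing_coeffs_Re_nonpos) (auto simp: fourier_coeff_cmult)
  from this[of 1] this[of "-1"] this[of \<i>] this[of "-\<i>"] show ?thesis
    by eventually_elim (simp add: complex_eq_iff)
qed

text \<open>
  Completeness is used in this form: a function with finitely many nonzero
  Fourier coefficients is the trigonometric polynomial that they define, so its norm
  is read off from them.
\<close>

lemma L2per_norm_finite_spectrum:
  assumes f: "integrable one_period f" and A: "finite A"
    and c: "\<And>k. fourier_coeff f k = (if k \<in> A then c k else 0)"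
  shows "L2per_norm f = sqrt (2 * pi * (\<Sum>k\<in>A. (cmod (c k))\<^sup>2))"
proof -
  let ?p = "\<lambda>x. \<Sum>k\<in>A. c k * fourier_mode k x"
  have "AE x in one_period. f x - ?p x = 0"
    using f A c by (intro vanishing_coeffs_imp_AE_zero)
      (auto simp: fourier_coeff_diff integrable_mode_sum fourier_coeff_mode_sum)
  then have "AE x in one_period. (cmod (f x))\<^sup>2 = (cmod (?p x))\<^sup>2"
    by eventually_elim simp
  then have "(LINT x|one_period. (cmod (f x))\<^sup>2) = (LINT x|one_period. (cmod (?p x))\<^sup>2)"
    using borel_measurable_integrable[OF f] borel_measurable_integrable[OF integrable_mode_sum[of c A]]
    by (intro integral_cong_AE) auto
  then show ?thesis
    using L2per_norm_mode_sum[OF A, of c] by (simp add: L2per_norm_def)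
qed

section \<open>Evolution of the Fourier coefficients\<close>

lemma dx_fourier_mode: "dx (\<lambda>x. c * fourier_mode k x) = (\<lambda>x. (c * \<i> * of_int k) * fourier_mode k x)"
  by (rule ext) (auto simp: dx_def intro!: vector_derivative_at
      derivative_eq_intros fourier_mode_has_vector_derivative)

lemma smooth_periodic_fourier_mode: "smooth_periodic (fourier_mode k)"
proof -
  have "(dx ^^ n) (fourier_mode k) = (\<lambda>x. (\<i> * of_int k) ^ n * fourier_mode k x)" for n
    by (induction n, simp, simp add: dx_fourier_mode, simp add: mult_ac)
  then have "(dx ^^ n) (fourier_mode k) differentiable at x" for n x
    using has_vector_derivative_mult_right[OF fourier_mode_has_vector_derivative]
    by (simp only:) (rule differentiableI_vector)
  then show ?thesis
    by (simp add: smooth_periodic_def fourier_mode_periodic)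
qed

text \<open>
  Testing the weak equation with \<open>e\<^sup>-\<^sup>i\<^sup>k\<^sup>x\<close> decouples it into one linear ordinary differential
  equation for each Fourier coefficient.
\<close>

lemma transport_solution_coeff_derivative:
  assumes w: "transport_solution \<nu> a T F w" and t: "t \<in> {0..T}"
    and F: "integrable one_period (F t)"
  shows "((\<lambda>s. fourier_coeff (w s) k) has_vector_derivative
      (- of_real \<nu> * (of_int k)\<^sup>2 - \<i> * of_real a * of_int k) * fourier_coeff (w t) k
        + fourier_coeff (F t) k) (at t within {0..T})"
proof -
  let ?\<phi> = "fourier_mode (- k)"
  define r where "r = - complex_of_real \<nu> * (of_int k)\<^sup>2 - \<i> * of_real a * of_int k"
  have dx1: "dx ?\<phi> = (\<lambda>x. (- \<i> * of_int k) * ?\<phi> x)"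
    using dx_fourier_mode[of 1 "- k"] by simp
  have dx2: "dx (dx ?\<phi>) = (\<lambda>x. - (of_int k)\<^sup>2 * ?\<phi> x)"
    unfolding dx1 dx_fourier_mode by (simp add: power2_eq_square algebra_simps)
  have wt: "integrable one_period (w t)"
    using w t by (auto simp: transport_solution_def intro: L2per_integrable)
  have "((\<lambda>s. LINT x|one_period. w s x * ?\<phi> x) has_vector_derivative
      (LINT x|one_period. w t x * (of_real \<nu> * dx (dx ?\<phi>) x + of_real a * dx ?\<phi> x)
        + F t x * ?\<phi> x)) (at t within {0..T})"
    using w t smooth_periodic_fourier_mode by (auto simp: transport_solution_def)
  also have "(\<lambda>x. w t x * (of_real \<nu> * dx (dx ?\<phi>) x + of_real a * dx ?\<phi> x) + F t x * ?\<phi> x)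
      = (\<lambda>x. r * (w t x * ?\<phi> x) + F t x * ?\<phi> x)"
    unfolding dx2 unfolding dx1 r_def by (simp add: algebra_simps)
  also have "(LINT x|one_period. r * (w t x * ?\<phi> x) + F t x * ?\<phi> x)
      = r * (LINT x|one_period. w t x * ?\<phi> x) + (LINT x|one_period. F t x * ?\<phi> x)"
    using wt F by (subst Bochner_Integration.integral_add)
      (auto intro!: integrable_mult_fourier_mode)
  finally have "((\<lambda>s. (LINT x|one_period. w s x * ?\<phi> x) / of_real (2 * pi)) has_vector_derivative
      (r * (LINT x|one_period. w t x * ?\<phi> x) + (LINT x|one_period. F t x * ?\<phi> x))
        / of_real (2 * pi)) (at t within {0..T})"
    by (rule has_vector_derivative_divide)
  then show ?thesis
    unfolding fourier_coeff_def r_def[symmetric] by (simp add: add_divide_distrib)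
qed

lemma linear_ode_solution:
  fixes y :: "real \<Rightarrow> complex"
  assumes y: "\<And>t. t \<in> {0..T} \<Longrightarrow> (y has_vector_derivative c * y t) (at t within {0..T})"
    and t: "t \<in> {0..T}"
  shows "y t = exp (c * of_real t) * y 0"
proof -
  (* The integrating factor makes the solution constant. *)
  define g where "g s = exp (- c * of_real s) * y s" for s
  have E: "((\<lambda>s. exp (- c * of_real s)) has_vector_derivative - c * exp (- c * of_real s))
      (at s within {0..T})" for s
  proof -
    have "((\<lambda>z. exp (- c * z)) has_field_derivative - c * exp (- c * of_real s)) (at (of_real s))"
      by (auto intro!: derivative_eq_intros)
    from has_vector_derivative_real_field[OF this] show ?thesis .
  qed
  have "(g has_vector_derivative 0) (at s within {0..T})" if "s \<in> {0..T}" for s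
    using has_vector_derivative_mult[OF E y[OF that]] by (simp add: g_def[abs_def] algebra_simps)
  then have "(g has_derivative (\<lambda>_. 0)) (at s within {0..T})" if "s \<in> {0..T}" for s
    using that by (force simp: has_vector_derivative_def)
  then obtain d where "\<And>s. s \<in> {0..T} \<Longrightarrow> g s = d"
    using has_derivative_zero_constant[of "{0..T}" g] by auto
  then have "g t = g 0" using t by auto
  then have "exp (c * of_real t) * g t = exp (c * of_real t) * y 0"
    by (simp add: g_def)
  then show ?thesis
    by (simp add: g_def flip: mult.assoc exp_add)
qed

text \<open>
  The forward problem is the case \<open>\<gamma> = \<mu>\<close>, the backward one the case \<open>\<gamma> = - \<mu>'\<close>. The nudging
  term shifts the exponent of the error by \<open>- \<gamma>\<close>, on the observed modes only.
\<close>

lemma nudging_error_coeff: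
  assumes u: "transport_solution \<nu> a T (\<lambda>t x. 0) u"
    and w: "transport_solution \<nu> a T (\<lambda>t x. of_real \<gamma> * proj_P M (\<lambda>y. u t y - w t y) x) w"
    and t: "t \<in> {0..T}"
  shows "fourier_coeff (u t) k - fourier_coeff (w t) k
      = exp ((- of_real \<nu> * (of_int k)\<^sup>2 - \<i> * of_real a * of_int k
          - (if \<bar>k\<bar> \<le> int M then of_real \<gamma> else 0)) * of_real t)
        * (fourier_coeff (u 0) k - fourier_coeff (w 0) k)"
proof (rule linear_ode_solution[of T "\<lambda>t. fourier_coeff (u t) k - fourier_coeff (w t) k", OF _ t])
  fix s assume s: "s \<in> {0..T}"
  have int: "integrable one_period (u s)" "integrable one_period (w s)"
    using u w s by (auto simp: transport_solution_def intro: L2per_integrable)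
  have F: "integrable one_period (\<lambda>x. of_real \<gamma> * proj_P M (\<lambda>y. u s y - w s y) x)"
    by (auto simp: proj_P_def intro!: integrable_mult_right integrable_mode_sum)
  have "fourier_coeff (\<lambda>x. 0) k = 0"
    by (simp add: fourier_coeff_def)
  then show "((\<lambda>t. fourier_coeff (u t) k - fourier_coeff (w t) k) has_vector_derivative
      (- of_real \<nu> * (of_int k)\<^sup>2 - \<i> * of_real a * of_int k
        - (if \<bar>k\<bar> \<le> int M then of_real \<gamma> else 0))
      * (fourier_coeff (u s) k - fourier_coeff (w s) k)) (at s within {0..T})"
    using has_vector_derivative_diff[OF transport_solution_coeff_derivative[OF u s, of k]
        transport_solution_coeff_derivative[OF w s F, of k]]
    by (simp add: fourier_coeff_cmult fourier_coeff_proj_P fourier_coeff_diff[OF int]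
        algebra_simps split: if_splits)
qed

section \<open>Back-and-forth nudging\<close>

text \<open>
  The transport exponent, acquired on the way forward, is undone on the way back; only the
  two nudging factors remain, and they act on the observed modes alone.
\<close>

lemma nudging_cycle_coeff:
  assumes T: "T > 0"
    and u: "transport_solution \<nu> a T (\<lambda>t x. 0) u"
    and w: "transport_solution \<nu> a T (\<lambda>t x. of_real \<mu> * proj_P M (\<lambda>y. u t y - w t y) x) w"
    and w': "transport_solution \<nu> a T (\<lambda>t x. - of_real \<mu>' * proj_P M (\<lambda>y. u t y - w' t y) x) w'"
    and eq: "eq_L2per (w' T) (w T)"
  shows "fourier_coeff (w' 0) k - fourier_coeff (u 0) k
      = of_real (if \<bar>k\<bar> \<le> int M then exp (- (\<mu> + \<mu>') * T) else 1)
        * (fourier_coeff (w 0) k - fourier_coeff (u 0) k)"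
proof -
  define r where "r = - complex_of_real \<nu> * (of_int k)\<^sup>2 - \<i> * of_real a * of_int k"
  define m m' where "m = (if \<bar>k\<bar> \<le> int M then complex_of_real \<mu> else 0)"
    and "m' = (if \<bar>k\<bar> \<le> int M then complex_of_real \<mu>' else 0)"
  define e e' where "e = fourier_coeff (u 0) k - fourier_coeff (w 0) k"
    and "e' = fourier_coeff (u 0) k - fourier_coeff (w' 0) k"
  have w'': "transport_solution \<nu> a T
      (\<lambda>t x. of_real (- \<mu>') * proj_P M (\<lambda>y. u t y - w' t y) x) w'"
    using w' by simp
  have "T \<in> {0..T}" using T by simp
  note forward = nudging_error_coeff[OF u w this, of k]
    and backward = nudging_error_coeff[OF u w'' this, of k]
  have "fourier_coeff (w' T) k = fourier_coeff (w T) k"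
    using w w' T by (intro fourier_coeff_cong_AE eq_L2per_AE_one_period[OF eq])
      (auto simp: transport_solution_def intro!: L2per_integrable)
  then have "exp ((r + m') * of_real T) * e' = exp ((r - m) * of_real T) * e"
    using forward backward by (auto simp: r_def m_def m'_def e_def e'_def split: if_splits)
  then have "exp (- (r + m') * of_real T) * (exp ((r + m') * of_real T) * e')
      = exp (- (r + m') * of_real T) * (exp ((r - m) * of_real T) * e)"
    by simp
  moreover have "- (r + m') * of_real T + (r + m') * of_real T = 0"
    "- (r + m') * of_real T + (r - m) * of_real T = - (m + m') * of_real T"
    by (simp_all add: algebra_simps)
  ultimately have "e' = exp (- (m + m') * of_real T) * e"
    by (simp only: mult.assoc[symmetric] exp_add[symmetric] exp_zero mult_1_left)
  also have "exp (- (m + m') * of_real T)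
      = of_real (if \<bar>k\<bar> \<le> int M then exp (- (\<mu> + \<mu>') * T) else 1)"
    by (simp add: m_def m'_def flip: exp_of_real)
  finally show ?thesis
    by (simp only: e_def e'_def) (simp add: algebra_simps split: if_splits)
qed

lemma trig_poly_coeffs:
  assumes "trig_poly K f"
  shows "integrable one_period f" and "\<bar>k\<bar> > int K \<Longrightarrow> fourier_coeff f k = 0"
  using assms by (auto simp: trig_poly_def fourier_coeff_mode_sum integrable_mode_sum)

theorem proposition3p3p1:
  fixes T a \<nu> \<mu> \<mu>' :: real
    and K M :: nat
    and u :: "real \<Rightarrow> real \<Rightarrow> complex"
    and v v' :: "nat \<Rightarrow> real \<Rightarrow> real \<Rightarrow> complex"
    and u0 v0 :: "real \<Rightarrow> complex"
  assumes "T > 0" and "a > 0" and "\<nu> \<ge> 0"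
    and "\<mu> \<ge> 0" and "\<mu>' \<ge> 0" and "\<mu> > 0 \<or> \<mu>' > 0"
    and "M \<le> K"
    and "trig_poly K u0" and "trig_poly K v0"
    and "transport_solution \<nu> a T (\<lambda>t x. 0) u"
    and "eq_L2per (u 0) u0"
    and "\<And>n. n \<ge> 1 \<Longrightarrow>
           transport_solution \<nu> a T
             (\<lambda>t x. of_real \<mu> * proj_P M (\<lambda>y. u t y - v n t y) x) (v n)"
    and "\<And>n. n \<ge> 1 \<Longrightarrow> eq_L2per (v n 0) (v' (n - 1) 0)"
    and "\<And>n. n \<ge> 1 \<Longrightarrow>
           transport_solution \<nu> a T
             (\<lambda>t x. - of_real \<mu>' * proj_P M (\<lambda>y. u t y - v' n t y) x) (v' n)"
    and "\<And>n. n \<ge> 1 \<Longrightarrow> eq_L2per (v' n T) (v n T)"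
    and "eq_L2per (v' 0 0) v0"
  shows "(\<lambda>n. L2per_norm (\<lambda>x. v n 0 x - u0 x))
           \<longlonglongrightarrow> L2per_norm (proj_Q M (\<lambda>x. v0 x - u0 x))"
proof -
  note u = assms(10) and u_init = assms(11) and v = assms(12) and v_init = assms(13)
    and v' = assms(14) and v'_final = assms(15) and v0_init = assms(16)
  note u0 = trig_poly_coeffs[OF assms(8)] and v0 = trig_poly_coeffs[OF assms(9)]
  define d where "d k = fourier_coeff v0 k - fourier_coeff u0 k" for k
  define q where "q k = (if \<bar>k\<bar> \<le> int M then exp (- (\<mu> + \<mu>') * T) else 1)" for k
  have d_outside: "d k = 0" if "k \<notin> {- int K..int K}" for k
  proof -
    have "\<bar>k\<bar> > int K" using that by auto
    then show ?thesis by (simp add: d_def u0 v0)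
  qed
  have int_u: "integrable one_period (u 0)"
    using u \<open>T > 0\<close> by (auto simp: transport_solution_def intro: L2per_integrable)
  have int_v: "integrable one_period (v n 0)" if "n \<ge> 1" for n
    using v[OF that] \<open>T > 0\<close> by (auto simp: transport_solution_def intro: L2per_integrable)
  have int_v': "integrable one_period (v' n 0)" if "n \<ge> 1" for n
    using v'[OF that] \<open>T > 0\<close> by (auto simp: transport_solution_def intro: L2per_integrable)
  have coeff_u: "fourier_coeff (u 0) k = fourier_coeff u0 k" for k
    by (intro fourier_coeff_cong_AE int_u u0 eq_L2per_AE_one_period[OF u_init])

  (* The exponent is off by one: the first iterate starts from v0 itself, before any cycle. *)
  have coeff: "fourier_coeff (v (Suc n) 0) k - fourier_coeff u0 k = of_real (q k ^ n) * d k" for n k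
  proof (induction n)
    case 0
    have "AE x in one_period. v 1 0 x = v0 x"
      using eq_L2per_AE_one_period[OF v_init[of 1]] eq_L2per_AE_one_period[OF v0_init]
      by (auto elim: eventually_elim2)
    then have "fourier_coeff (v 1 0) k = fourier_coeff v0 k"
      by (intro fourier_coeff_cong_AE int_v v0) auto
    then show ?case by (simp add: d_def)
  next
    case (Suc n)
    have "AE x in one_period. v (Suc (Suc n)) 0 x = v' (Suc n) 0 x"
      using eq_L2per_AE_one_period[OF v_init[of "Suc (Suc n)"]] by simp
    then have "fourier_coeff (v (Suc (Suc n)) 0) k = fourier_coeff (v' (Suc n) 0) k"
      by (intro fourier_coeff_cong_AE int_v int_v') auto
    then have "fourier_coeff (v (Suc (Suc n)) 0) k - fourier_coeff u0 k
        = of_real (q k) * (fourier_coeff (v (Suc n) 0) k - fourier_coeff u0 k)"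
      using nudging_cycle_coeff[OF \<open>T > 0\<close> u v v' v'_final, of "Suc n" k]
      by (simp add: q_def coeff_u)
    then show ?case using Suc by (simp add: mult.assoc)
  qed

  have norm_v: "L2per_norm (\<lambda>x. v (Suc n) 0 x - u0 x)
      = sqrt (2 * pi * (\<Sum>k = - int K..int K. (cmod (of_real (q k ^ n) * d k))\<^sup>2))" for n
  proof (rule L2per_norm_finite_spectrum)
    show "integrable one_period (\<lambda>x. v (Suc n) 0 x - u0 x)"
      using int_v u0 by auto
    show "fourier_coeff (\<lambda>x. v (Suc n) 0 x - u0 x) k
        = (if k \<in> {- int K..int K} then of_real (q k ^ n) * d k else 0)" for k
      using d_outside[of k] coeff[of n k] by (simp add: fourier_coeff_diff int_v u0 del: atLeastAtMost_iff)
  qed simp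

  define q_lim where "q_lim k = (if \<bar>k\<bar> \<le> int M then 0 else 1 :: real)" for k :: int
  have norm_Q: "L2per_norm (proj_Q M (\<lambda>x. v0 x - u0 x))
      = sqrt (2 * pi * (\<Sum>k = - int K..int K. (cmod (of_real (q_lim k) * d k))\<^sup>2))"
  proof (rule L2per_norm_finite_spectrum)
    have int_P: "integrable one_period (proj_P M (\<lambda>x. v0 x - u0 x))"
      by (simp add: proj_P_def[abs_def] integrable_mode_sum)
    have int_d: "integrable one_period (\<lambda>x. v0 x - u0 x)"
      using u0 v0 by auto
    show "integrable one_period (proj_Q M (\<lambda>x. v0 x - u0 x))"
      unfolding proj_Q_def[abs_def] using int_P int_d by (rule Bochner_Integration.integrable_diff[rotated])
    show "fourier_coeff (proj_Q M (\<lambda>x. v0 x - u0 x)) k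
        = (if k \<in> {- int K..int K} then of_real (q_lim k) * d k else 0)" for k
      using d_outside[of k] unfolding proj_Q_def[abs_def]
      by (simp add: fourier_coeff_diff[OF int_d int_P] fourier_coeff_proj_P fourier_coeff_diff u0 v0
          d_def q_lim_def del: atLeastAtMost_iff)
  qed simp

  have "(\<lambda>n. q k ^ n) \<longlonglongrightarrow> q_lim k" for k
  proof (cases "\<bar>k\<bar> \<le> int M")
    case True
    have "(\<mu> + \<mu>') * T > 0"
      using \<open>T > 0\<close> \<open>\<mu> \<ge> 0\<close> \<open>\<mu>' \<ge> 0\<close> \<open>\<mu> > 0 \<or> \<mu>' > 0\<close> by (intro mult_pos_pos) auto
    then have "norm (exp (- (\<mu> + \<mu>') * T)) < 1" by (simp add: algebra_simps)
    then show ?thesis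
      using True by (simp only: q_def q_lim_def if_True LIMSEQ_power_zero)
  qed (simp add: q_def q_lim_def)
  then have "(\<lambda>n. L2per_norm (\<lambda>x. v (Suc n) 0 x - u0 x))
      \<longlonglongrightarrow> L2per_norm (proj_Q M (\<lambda>x. v0 x - u0 x))"
    unfolding norm_v norm_Q by (intro tendsto_intros)
  then show ?thesis by (rule LIMSEQ_imp_Suc)
qed

end
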